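(* Let $\mathcal{K}$ be a unital associative algebra over $\mathbb{C}$ (not necessarily commutative) and let $M$ be an $n\times n$ Manin matrix over $\mathcal{K}$. Put $S_0=1$ and, for $k\ge1$, $$S_k=\mathrm{Tr}\,S^kM:=\frac1{k!}\sum_{1\le l_1,\dots,l_k\le n}\mathrm{perm}^{row}\bigl((M_{l_al_b})_{1\le a,b\le k}\bigr)$$ (repeated indices are allowed in the sum). Let $S(t)=\sum_{k\ge0}t^kS_k$ and $T(t)=\sum_{k\ge0}t^k\,\mathrm{Tr}(M^{k+1})=\mathrm{Tr}\frac{M}{1-tM}$, as formal power series in $t$. Then $$\partial_tS(t)=T(t)\,S(t),$$ equivalently, for all $k>0$, $\ k\,S_k=\sum_{i=0}^{k-1}\mathrm{Tr}(M^{k-i})\,S_i$. If instead $M^t$ (the transpose of $M$) is a Manin matrix and $S_k$ is defined by the same formula with column permanents $\mathrm{perm}^{col}$ in place of $\mathrm{perm}^{row}$, then the same holds with the reversed order: $\partial_tS(t)=S(t)\,T(t)$, equivalently $k\,S_k=\sum_{i=0}^{k-1}S_i\,\mathrm{Tr}(M^{k-i})$ for all $k>0$.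
   Context: A (possibly rectangular) matrix $M=(M_{ij})$ with entries in an associative ring $\mathcal{K}$ is called a Manin matrix if (1) entries lying in the same column commute with each other, and (2) $[M_{ij},M_{kl}]=[M_{kj},M_{il}]$ for all $i,j,k,l$, where $[a,b]=ab-ba$. For a $k\times k$ matrix $X$ over $\mathcal{K}$: $\mathrm{perm}^{row}(X)=\sum_{\sigma\in S_k}X_{1\sigma(1)}X_{2\sigma(2)}\cdots X_{k\sigma(k)}$ and $\mathrm{perm}^{col}(X)=\sum_{\sigma\in S_k}X_{\sigma(1)1}X_{\sigma(2)2}\cdots X_{\sigma(k)k}$, with the factors written in the indicated order. The formal variable $t$ commutes with $\mathcal{K}$. *)

theory Defs
  imports
    Complex_Main
    "HOL-Library.FuncSet"
    "HOL-Combinatorics.Permutations"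
    "HOL-Computational_Algebra.Formal_Power_Series"
    "Jordan_Normal_Form.Matrix"
begin

class complex_algebra_1 = ring_1 +
  fixes scaleC :: "complex \<Rightarrow> 'a \<Rightarrow> 'a"  (infixr "*\<^sub>C" 75)
  assumes scaleC_add_right: "c *\<^sub>C (x + y) = c *\<^sub>C x + c *\<^sub>C y"
    and scaleC_add_left: "(c + d) *\<^sub>C x = c *\<^sub>C x + d *\<^sub>C x"
    and scaleC_scaleC: "c *\<^sub>C d *\<^sub>C x = (c * d) *\<^sub>C x"
    and scaleC_one: "1 *\<^sub>C x = x"
    and mult_scaleC_left: "(c *\<^sub>C x) * y = c *\<^sub>C (x * y)"
    and mult_scaleC_right: "x * (c *\<^sub>C y) = c *\<^sub>C (x * y)"

definition commutator :: "'a::ring \<Rightarrow> 'a \<Rightarrow> 'a" where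
  "commutator a b = a * b - b * a"

definition manin_mat :: "'a::ring mat \<Rightarrow> bool" where
  "manin_mat M \<longleftrightarrow>
    (\<forall>i < dim_row M. \<forall>k < dim_row M. \<forall>j < dim_col M.
        M $$ (i, j) * M $$ (k, j) = M $$ (k, j) * M $$ (i, j)) \<and>
    (\<forall>i < dim_row M. \<forall>k < dim_row M. \<forall>j < dim_col M. \<forall>l < dim_col M.
        commutator (M $$ (i, j)) (M $$ (k, l)) = commutator (M $$ (k, j)) (M $$ (i, l)))"

definition mat_trace :: "'a::comm_monoid_add mat \<Rightarrow> 'a" where
  "mat_trace A = (\<Sum>i\<in>{0..<dim_row A}. A $$ (i, i))"

text \<open>The entries need not commute, so the products are taken over lists: the order of the
  factors is that of the rows, respectively of the columns.\<close>

definition perm_row :: "'a::semiring_1 mat \<Rightarrow> 'a" where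
  "perm_row X = (\<Sum>\<sigma> | \<sigma> permutes {0..<dim_row X}.
      prod_list (map (\<lambda>i. X $$ (i, \<sigma> i)) [0..<dim_row X]))"

definition perm_col :: "'a::semiring_1 mat \<Rightarrow> 'a" where
  "perm_col X = (\<Sum>\<sigma> | \<sigma> permutes {0..<dim_col X}.
      prod_list (map (\<lambda>i. X $$ (\<sigma> i, i)) [0..<dim_col X]))"

text \<open>The trace of the \<open>k\<close>-th symmetric power of \<open>M\<close>, relative to a choice \<open>perm\<close> of
  noncommutative permanent. The tuples \<open>l\<close> may have repeated entries.\<close>

definition sym_pow_trace ::
  "('a::complex_algebra_1 mat \<Rightarrow> 'a) \<Rightarrow> 'a mat \<Rightarrow> nat \<Rightarrow> 'a" where
  "sym_pow_trace perm M k =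
    (if k = 0 then 1
     else (1 / fact k) *\<^sub>C
       (\<Sum>l \<in> {0..<k} \<rightarrow>\<^sub>E {0..<dim_row M}. perm (mat k k (\<lambda>(a, b). M $$ (l a, l b)))))"

definition sym_series ::
  "('a::complex_algebra_1 mat \<Rightarrow> 'a) \<Rightarrow> 'a mat \<Rightarrow> 'a fps" where
  "sym_series perm M = Abs_fps (\<lambda>k. sym_pow_trace perm M k)"

definition trace_series :: "'a::semiring_1 mat \<Rightarrow> 'a fps" where
  "trace_series M = Abs_fps (\<lambda>k. mat_trace (M ^\<^sub>m (k + 1)))"

end

theory Submission
  imports Defs
begin

text \<open>
  For index tuples \<open>I\<close>, \<open>J\<close> let \<open>P(I; J)\<close> be the permanent of the submatrix with rows \<open>I\<close> and
  columns \<open>J\<close>. It is trivially symmetric in \<open>J\<close>; the Manin relations, in the form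
  \<open>[M\<^sub>i\<^sub>j, M\<^sub>k\<^sub>l] + [M\<^sub>i\<^sub>l, M\<^sub>k\<^sub>j] = 0\<close>, make it symmetric in \<open>I\<close> as well. Put
  \<open>Q(m, r) = \<Sum> (M\<^sup>m)\<^sub>x\<^sub>y P(y l; x l)\<close>, summed over indices \<open>x\<close>, \<open>y\<close> and \<open>r\<close>-tuples \<open>l\<close>. Expanding
  along row \<open>y\<close>, the column \<open>x\<close> contributes \<open>Tr(M\<^sup>m\<^sup>+\<^sup>1)\<close> times the sum of all \<open>P(l; l)\<close>, and by the
  two symmetries each of the other \<open>r\<close> columns contributes \<open>Q(m + 1, r - 1)\<close>. Iterating from
  \<open>Q(0, k - 1) = k! S\<^sub>k\<close> gives Newton's identities.

  The case of column permanents is the same argument in the opposite algebra.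
\<close>

section \<open>Sums over tuples, and complex scalars\<close>

lemma bij_betw_PiE_compose:
  assumes "p permutes A"
  shows "bij_betw (\<lambda>l. l \<circ> p) (A \<rightarrow>\<^sub>E B) (A \<rightarrow>\<^sub>E B)"
proof (rule bij_betw_byWitness[where f' = "\<lambda>l. l \<circ> inv_into UNIV p"])
  have comp: "l \<circ> q \<in> A \<rightarrow>\<^sub>E B" if "q permutes A" "l \<in> A \<rightarrow>\<^sub>E B" for q l
    using that permutes_in_image[OF that(1)] permutes_not_in[OF that(1)]
    by (auto simp: PiE_iff extensional_def)
  show "(\<lambda>l. l \<circ> p) ` (A \<rightarrow>\<^sub>E B) \<subseteq> A \<rightarrow>\<^sub>E B" "(\<lambda>l. l \<circ> inv_into UNIV p) ` (A \<rightarrow>\<^sub>E B) \<subseteq> A \<rightarrow>\<^sub>E B"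
    using comp assms permutes_inv[OF assms] by blast+
  show "\<forall>l\<in>A \<rightarrow>\<^sub>E B. (l \<circ> p) \<circ> inv_into UNIV p = l" "\<forall>l\<in>A \<rightarrow>\<^sub>E B. (l \<circ> inv_into UNIV p) \<circ> p = l"
    by (simp_all add: comp_assoc permutes_inv_o[OF assms])
qed

lemmas sum_PiE_compose = sum.reindex_bij_betw[OF bij_betw_PiE_compose]

lemma sum_PiE_insert:
  assumes "x \<notin> S"
  shows "sum f (insert x S \<rightarrow>\<^sub>E T) = (\<Sum>y\<in>T. \<Sum>l\<in>S \<rightarrow>\<^sub>E T. f (l(x := y)))"
  using inj_combinator[OF assms, of "\<lambda>_. T"]
  by (simp add: PiE_insert_eq sum.reindex sum.cartesian_product case_prod_unfold)

text \<open>Antisymmetry arguments only show that twice an element vanishes; the scalar 1/2 removes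
  the factor.\<close>

lemma double_eq_zero_iff:
  fixes x :: "'a::complex_algebra_1"
  shows "x + x = 0 \<longleftrightarrow> x = 0"
proof
  assume "x + x = 0"
  moreover have "x + x = 2 *\<^sub>C x"
    using scaleC_add_left[of 1 1 x] by (simp add: scaleC_one)
  moreover have "x = (1/2) *\<^sub>C 2 *\<^sub>C x"
    by (simp add: scaleC_scaleC scaleC_one)
  moreover have "(1/2) *\<^sub>C (0::'a) = 0"
    using scaleC_add_right[of "1/2" "0::'a" 0] by simp
  ultimately show "x = 0" by simp
qed simp

lemma scaleC_of_nat: "of_nat k *\<^sub>C x = of_nat k * x"
proof (induction k)
  case 0
  show ?case using scaleC_add_left[of 0 0 x] by simp
next
  case (Suc k)
  then show ?case by (simp add: scaleC_add_left scaleC_one distrib_right)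
qed

text \<open>Allowing \<open>mul\<close> to be the opposite multiplication covers both versions of the theorem:
  expansion is always along the last row, whose entry ends up leftmost if \<open>mul\<close> is reversed.
  The array is total, so the relations carry no index bounds; see \<open>entries\<close> below.\<close>

locale manin_array =
  fixes mul :: "'a::complex_algebra_1 \<Rightarrow> 'a \<Rightarrow> 'a" (infixl "\<odot>" 70)
    and N :: "nat \<Rightarrow> nat \<Rightarrow> 'a"
    and n :: nat
  assumes mul_cases: "mul = (*) \<or> mul = (\<lambda>x y. y * x)"
    and manin: "N i j \<odot> N k l + N i l \<odot> N k j = N k j \<odot> N i l + N k l \<odot> N i j"
begin

lemma mul_assoc: "x \<odot> y \<odot> z = x \<odot> (y \<odot> z)"
  and mul_one: "1 \<odot> x = x" "x \<odot> 1 = x"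
  and mul_zero: "0 \<odot> x = 0" "x \<odot> 0 = 0"
  and mul_add_right: "x \<odot> (y + z) = x \<odot> y + x \<odot> z"
  and mul_add_left: "(y + z) \<odot> x = y \<odot> x + z \<odot> x"
  and mul_of_nat_left: "(of_nat m * x) \<odot> y = of_nat m * (x \<odot> y)"
  using mul_cases
  by (auto simp: mult.assoc algebra_simps mult_of_nat_commute)

lemma mul_sum_left: "sum f A \<odot> y = (\<Sum>a\<in>A. f a \<odot> y)"
  and mul_sum_right: "y \<odot> sum f A = (\<Sum>a\<in>A. y \<odot> f a)"
  using mul_cases by (auto simp: sum_distrib_left sum_distrib_right)

section \<open>Permanents and their symmetry in rows and columns\<close>

primrec mprod :: "nat \<Rightarrow> (nat \<Rightarrow> 'a) \<Rightarrow> 'a" where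
  "mprod 0 f = 1"
| "mprod (Suc k) f = mprod k f \<odot> f k"

lemma mprod_cong: "(\<And>a. a < k \<Longrightarrow> f a = g a) \<Longrightarrow> mprod k f = mprod k g"
  by (induction k) auto

definition mperm :: "nat \<Rightarrow> (nat \<Rightarrow> nat) \<Rightarrow> (nat \<Rightarrow> nat) \<Rightarrow> 'a" where
  "mperm k I J = (\<Sum>\<sigma> | \<sigma> permutes {0..<k}. mprod k (\<lambda>a. N (I a) (J (\<sigma> a))))"

lemma mperm_cong:
  assumes "\<And>a. a < k \<Longrightarrow> I a = I' a" "\<And>a. a < k \<Longrightarrow> J a = J' a"
  shows "mperm k I J = mperm k I' J'"
  unfolding mperm_def
proof (intro sum.cong refl mprod_cong)
  fix \<sigma> a assume "\<sigma> \<in> {\<sigma>. \<sigma> permutes {0..<k}}" "a < k"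
  moreover from this have "\<sigma> a < k"
    using permutes_in_image[of \<sigma> "{0..<k}" a] by simp
  ultimately show "N (I a) (J (\<sigma> a)) = N (I' a) (J' (\<sigma> a))" by (simp add: assms)
qed

lemma mperm_0 [simp]: "mperm 0 I J = 1"
  by (simp add: mperm_def)

text \<open>A permutation of k + 1 points is uniquely \<open>transpose k b \<circ> \<sigma>\<close>
  with \<sigma> fixing k. It sends row k to column b, and the entry of that row is the last factor,
  so it splits off without any commutation.\<close>

lemma mperm_Suc:
  "mperm (Suc k) I J = (\<Sum>b<Suc k. mperm k I (J \<circ> transpose k b) \<odot> N (I k) (J b))"
proof -
  have "mperm (Suc k) I J =
      (\<Sum>b\<in>insert k {0..<k}. \<Sum>\<sigma> | \<sigma> permutes {0..<k}.
         mprod (Suc k) (\<lambda>a. N (I a) (J ((transpose k b \<circ> \<sigma>) a))))"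
    unfolding mperm_def atLeast0_lessThan_Suc by (rule sum_over_permutations_insert) auto
  also have "\<dots> = (\<Sum>b\<in>insert k {0..<k}. mperm k I (J \<circ> transpose k b) \<odot> N (I k) (J b))"
  proof (rule sum.cong[OF refl])
    fix b
    show "(\<Sum>\<sigma> | \<sigma> permutes {0..<k}. mprod (Suc k) (\<lambda>a. N (I a) (J ((transpose k b \<circ> \<sigma>) a)))) =
        mperm k I (J \<circ> transpose k b) \<odot> N (I k) (J b)"
      by (auto simp: mperm_def mul_sum_left permutes_not_in[where x = k] intro!: sum.cong)
  qed
  also have "insert k {0..<k} = {..<Suc k}" by auto
  finally show ?thesis .
qed

lemma mperm_cols:
  assumes "p permutes {0..<k}"
  shows "mperm k I (J \<circ> p) = mperm k I J"
  unfolding mperm_def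
  by (subst (2) setum_permutations_compose_left[OF assms]) simp

text \<open>The last two rows contribute adjacent factors, so the Manin relation applies without
  moving any other factor.\<close>

lemma mperm_swap_last_rows:
  "mperm (Suc (Suc k)) (I \<circ> transpose k (Suc k)) J = mperm (Suc (Suc k)) I J"
proof -
  let ?\<tau> = "transpose k (Suc k)"
  \<comment> \<open>The Manin relation makes \<open>d\<close> antisymmetric under \<open>\<sigma> \<mapsto> \<sigma> \<circ> \<tau>\<close>, hence its sum vanishes.\<close>
  define d where "d \<sigma> =
    mprod (Suc (Suc k)) (\<lambda>a. N (I a) (J (\<sigma> a))) -
    mprod (Suc (Suc k)) (\<lambda>a. N ((I \<circ> ?\<tau>) a) (J (\<sigma> a)))" for \<sigma> :: "nat \<Rightarrow> nat"
  let ?P = "{\<sigma>. \<sigma> permutes {0..<Suc (Suc k)}}"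
  have \<tau>: "?\<tau> permutes {0..<Suc (Suc k)}" by (rule permutes_swap_id) auto
  have "d \<sigma> + d (\<sigma> \<circ> ?\<tau>) = 0" for \<sigma>
  proof -
    \<comment> \<open>The transposition fixes every index below k, so all four products share their
      first k factors; the claim is the Manin relation multiplied by this prefix.\<close>
    have *: "mprod k (\<lambda>a. N (I (?\<tau> a)) (J (\<sigma> a))) = mprod k (\<lambda>a. N (I a) (J (\<sigma> a)))"
      "mprod k (\<lambda>a. N (I (?\<tau> a)) (J (\<sigma> (?\<tau> a)))) = mprod k (\<lambda>a. N (I a) (J (\<sigma> a)))"
      "mprod k (\<lambda>a. N (I a) (J (\<sigma> (?\<tau> a)))) = mprod k (\<lambda>a. N (I a) (J (\<sigma> a)))"
      by (auto intro!: mprod_cong simp: transpose_apply_other)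
    show ?thesis
      using arg_cong[OF manin[of "I k" "J (\<sigma> k)" "I (Suc k)" "J (\<sigma> (Suc k))"],
          of "\<lambda>x. mprod k (\<lambda>a. N (I a) (J (\<sigma> a))) \<odot> x"]
      by (simp add: d_def * mul_assoc mul_add_right algebra_simps)
  qed
  then have "sum d ?P + sum (\<lambda>\<sigma>. d (\<sigma> \<circ> ?\<tau>)) ?P = 0"
    by (simp flip: sum.distrib)
  then have "sum d ?P = 0"
    by (simp add: sum_permutations_compose_right[OF \<tau>, of d, symmetric] double_eq_zero_iff)
  then show ?thesis
    by (simp add: d_def mperm_def sum_subtractf)
qed

text \<open>Swaps among the first k rows pass through the expansion along the last row. A swap with
  the last row is the swap of the last two rows, conjugated by a swap of the former kind.\<close>

lemma mperm_transpose_rows: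
  "a < k \<Longrightarrow> b < k \<Longrightarrow> mperm k (I \<circ> transpose a b) J = mperm k I J"
proof (induction k arbitrary: I J a b)
  case (Suc k)
  have less: "mperm (Suc k) (I \<circ> transpose a b) J = mperm (Suc k) I J" if "a < k" "b < k" for a b I
  proof -
    have "(I \<circ> transpose a b) k = I k" using that by (simp add: transpose_apply_other)
    then show ?thesis unfolding mperm_Suc by (simp only: Suc.IH[OF that])
  qed
  have last: "mperm (Suc k) (I \<circ> transpose a k) J = mperm (Suc k) I J" if "a < k" for a I
  proof -
    obtain m where m: "k = Suc m" using \<open>a < k\<close> by (cases k) auto
    show ?thesis
    proof (cases "a = m")
      case True
      then show ?thesis using mperm_swap_last_rows m by simp
    next
      case False
      then have "transpose a k = transpose a m \<circ> transpose m k \<circ> transpose a m"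
        using that m by (auto simp: fun_eq_iff transpose_def)
      then have "I \<circ> transpose a k = I \<circ> transpose a m \<circ> transpose m k \<circ> transpose a m"
        by (simp add: comp_assoc)
      then show ?thesis
        using that m False less[of a m] mperm_swap_last_rows[of m] by simp
    qed
  qed
  consider "a < k" "b < k" | "a < k" "b = k" | "a = k" "b < k" | "a = k" "b = k"
    using Suc.prems by linarith
  then show ?case
  proof cases
    case 1
    then show ?thesis by (rule less)
  next
    case 2
    then show ?thesis by (simp only: last)
  next
    case 3
    then show ?thesis by (simp only: last transpose_commute[of k])
  next
    case 4
    then show ?thesis by simp
  qed
qed simp

lemma mperm_transpose_rows_cols:
  assumes "a < k" "b < k"
  shows "mperm k (I \<circ> transpose a b) (J \<circ> transpose a b) = mperm k I J"
  using assms by (simp add: mperm_transpose_rows mperm_cols permutes_swap_id)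

text \<open>The transpose of the matrix power for the opposite multiplication; the power of the transposed
  array for the given one.\<close>

primrec mpow :: "nat \<Rightarrow> nat \<Rightarrow> nat \<Rightarrow> 'a" where
  "mpow 0 x y = (if x = y then 1 else 0)"
| "mpow (Suc m) x y = (\<Sum>z<n. N z x \<odot> mpow m z y)"

section \<open>Hook sums and their recursion\<close>

definition tuples :: "nat \<Rightarrow> (nat \<Rightarrow> nat) set" where
  "tuples r = {0..<r} \<rightarrow>\<^sub>E {..<n}"

lemma sum_tuples_Suc:
  "sum f (tuples (Suc r)) = (\<Sum>y<n. \<Sum>l\<in>tuples r. f (l(r := y)))"
  by (simp add: tuples_def atLeast0_lessThan_Suc sum_PiE_insert)

definition symsum :: "nat \<Rightarrow> 'a" where
  "symsum r = (\<Sum>l\<in>tuples r. mperm r l l)"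

definition mtrace :: "nat \<Rightarrow> 'a" where
  "mtrace m = (\<Sum>x<n. mpow m x x)"

text \<open>This is Q(m, r) of the introduction. The extra row y and column x sit in the last
  position, where \<open>mperm_Suc\<close> expands.\<close>

definition hooksum :: "nat \<Rightarrow> nat \<Rightarrow> 'a" where
  "hooksum m r = (\<Sum>x<n. \<Sum>y<n. \<Sum>l\<in>tuples r.
     mperm (Suc r) (l(r := y)) (l(r := x)) \<odot> mpow m y x)"

text \<open>\<open>mpow 0\<close> is the identity and forces x = y; then \<open>l(r := x)\<close>
  runs through all tuples of length r + 1.\<close>

lemma symsum_Suc: "symsum (Suc r) = hooksum 0 r"
proof -
  have "(\<Sum>y<n. \<Sum>l\<in>tuples r. mperm (Suc r) (l(r := y)) (l(r := x)) \<odot> mpow 0 y x) =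
      (\<Sum>l\<in>tuples r. mperm (Suc r) (l(r := x)) (l(r := x)))" if "x < n" for x
  proof -
    have "(\<Sum>y<n. \<Sum>l\<in>tuples r. mperm (Suc r) (l(r := y)) (l(r := x)) \<odot> mpow 0 y x) =
      (\<Sum>y<n. if y = x then \<Sum>l\<in>tuples r. mperm (Suc r) (l(r := x)) (l(r := x)) else 0)"
      by (intro sum.cong refl) (auto simp: mul_one mul_zero)
    then show ?thesis using that by simp
  qed
  then show ?thesis
    by (simp add: symsum_def hooksum_def sum_tuples_Suc del: mpow.simps)
qed

text \<open>Expansion along row y: choosing column x leaves l against l, while choosing column
  \<open>l b\<close> lets the transposition move x into position b.\<close>

lemma mperm_hook_Suc:
  "mperm (Suc r) (l(r := y)) (l(r := x)) =
     (\<Sum>b<r. mperm r l (l(b := x)) \<odot> N y (l b)) + mperm r l l \<odot> N y x"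
proof -
  have "mperm r (l(r := y)) (l(r := x) \<circ> transpose r b) = mperm r l (l(b := x))" if "b < r" for b
    using that by (intro mperm_cong) (auto simp: transpose_def)
  moreover have "mperm r (l(r := y)) (l(r := x)) = mperm r l l"
    by (intro mperm_cong) auto
  ultimately show ?thesis
    by (simp add: mperm_Suc)
qed

text \<open>Exchanging positions b and r permutes the tuples and, by symmetry in rows and columns,
  preserves the permanent. Hence all positions contribute equally.\<close>

lemma sum_hook_position:
  assumes "b < Suc r"
  shows "(\<Sum>l\<in>tuples (Suc r). mperm (Suc r) l (l(b := x)) \<odot> g (l b)) =
    (\<Sum>l\<in>tuples (Suc r). mperm (Suc r) l (l(r := x)) \<odot> g (l r))"
proof -
  let ?\<tau> = "transpose b r"
  have "(\<Sum>l\<in>tuples (Suc r). mperm (Suc r) l (l(r := x)) \<odot> g (l r)) =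
      (\<Sum>l\<in>tuples (Suc r). mperm (Suc r) (l \<circ> ?\<tau>) ((l \<circ> ?\<tau>)(r := x)) \<odot> g ((l \<circ> ?\<tau>) r))"
    unfolding tuples_def
    by (rule sum_PiE_compose[symmetric]) (use assms in \<open>auto intro: permutes_swap_id\<close>)
  also have "\<dots> = (\<Sum>l\<in>tuples (Suc r). mperm (Suc r) l (l(b := x)) \<odot> g (l b))"
  proof (rule sum.cong[OF refl])
    fix l
    have "(l \<circ> ?\<tau>)(r := x) = l(b := x) \<circ> ?\<tau>"
      by (auto simp: fun_eq_iff transpose_def)
    then show "mperm (Suc r) (l \<circ> ?\<tau>) ((l \<circ> ?\<tau>)(r := x)) \<odot> g ((l \<circ> ?\<tau>) r) =
        mperm (Suc r) l (l(b := x)) \<odot> g (l b)"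
      using assms mperm_transpose_rows_cols[of b "Suc r" r l "l(b := x)"] by simp
  qed
  finally show ?thesis by simp
qed

lemma hooksum_rec:
  "hooksum m r = symsum r \<odot> mtrace (Suc m) + of_nat r * hooksum (Suc m) (r - 1)"
proof -
  have "hooksum m r =
      (\<Sum>x<n. \<Sum>y<n. \<Sum>l\<in>tuples r. \<Sum>b<r. mperm r l (l(b := x)) \<odot> N y (l b) \<odot> mpow m y x) +
      (\<Sum>x<n. \<Sum>y<n. \<Sum>l\<in>tuples r. mperm r l l \<odot> N y x \<odot> mpow m y x)"
    by (simp add: hooksum_def mperm_hook_Suc mul_add_left mul_sum_left sum.distrib)
  also have "(\<Sum>x<n. \<Sum>y<n. \<Sum>l\<in>tuples r. mperm r l l \<odot> N y x \<odot> mpow m y x) =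
      symsum r \<odot> mtrace (Suc m)"
    by (simp add: symsum_def mtrace_def mul_sum_left mul_sum_right mul_assoc sum.swap[of _ "tuples r"])
  also have "(\<Sum>x<n. \<Sum>y<n. \<Sum>l\<in>tuples r. \<Sum>b<r. mperm r l (l(b := x)) \<odot> N y (l b) \<odot> mpow m y x) =
      (\<Sum>x<n. \<Sum>b<r. \<Sum>l\<in>tuples r. mperm r l (l(b := x)) \<odot> mpow (Suc m) (l b) x)"
  proof (rule sum.cong[OF refl])
    fix x
    have "(\<Sum>y<n. \<Sum>l\<in>tuples r. \<Sum>b<r. mperm r l (l(b := x)) \<odot> N y (l b) \<odot> mpow m y x) =
      (\<Sum>y<n. \<Sum>b<r. \<Sum>l\<in>tuples r. mperm r l (l(b := x)) \<odot> N y (l b) \<odot> mpow m y x)"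
      by (intro sum.cong refl sum.swap)
    also have "\<dots> = (\<Sum>b<r. \<Sum>y<n. \<Sum>l\<in>tuples r. mperm r l (l(b := x)) \<odot> N y (l b) \<odot> mpow m y x)"
      by (rule sum.swap)
    also have "\<dots> = (\<Sum>b<r. \<Sum>l\<in>tuples r. \<Sum>y<n. mperm r l (l(b := x)) \<odot> N y (l b) \<odot> mpow m y x)"
      by (intro sum.cong refl sum.swap)
    finally show "(\<Sum>y<n. \<Sum>l\<in>tuples r. \<Sum>b<r. mperm r l (l(b := x)) \<odot> N y (l b) \<odot> mpow m y x) =
      (\<Sum>b<r. \<Sum>l\<in>tuples r. mperm r l (l(b := x)) \<odot> mpow (Suc m) (l b) x)"
      \<comment> \<open>Summing \<open>N y (l b) \<odot> mpow m y x\<close> over y gives the next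
        power.\<close>
      by (simp add: mul_sum_right mul_assoc)
  qed
  also have "\<dots> = of_nat r * hooksum (Suc m) (r - 1)"
  \<comment> \<open>For r = 0 both sides vanish, so the truncated \<open>r - 1\<close> is
    harmless.\<close>
  proof (cases r)
    case (Suc q)
    have "(\<Sum>x<n. \<Sum>b<r. \<Sum>l\<in>tuples r. mperm r l (l(b := x)) \<odot> mpow (Suc m) (l b) x) =
        (\<Sum>x<n. \<Sum>b<r. \<Sum>l\<in>tuples r. mperm r l (l(q := x)) \<odot> mpow (Suc m) (l q) x)"
      unfolding Suc
      by (intro sum.cong refl sum_hook_position[where g = "\<lambda>z. mpow (Suc m) z _"]) simp
    \<comment> \<open>The last entry of the tuple is split off and becomes the new y.\<close>
    also have "\<dots> = of_nat r * hooksum (Suc m) (r - 1)"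
      by (simp add: Suc hooksum_def sum_distrib_left sum_tuples_Suc del: mpow.simps of_nat_Suc)
    finally show ?thesis .
  qed simp
  finally show ?thesis by (simp add: add.commute)
qed

section \<open>Newton's identities for the array\<close>

definition symtrace :: "nat \<Rightarrow> 'a" where
  "symtrace k = (1 / fact k) *\<^sub>C symsum k"

lemma symsum_eq: "symsum k = of_nat (fact k) * symtrace k"
  by (simp add: symtrace_def scaleC_of_nat[symmetric] scaleC_scaleC scaleC_one)

text \<open>Each use of \<open>hooksum_rec\<close> keeps m + r fixed, and r (r - 1) ... (i + 1)
  times the i! from \<open>symsum_eq\<close> is always r!.\<close>

lemma hooksum_eq:
  "hooksum m r = of_nat (fact r) * (\<Sum>i\<le>r. symtrace i \<odot> mtrace (Suc m + r - i))"
proof (induction r arbitrary: m)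
  case 0
  show ?case by (subst hooksum_rec) (simp add: symsum_eq)
next
  case (Suc r)
  have "hooksum m (Suc r) = symsum (Suc r) \<odot> mtrace (Suc m) +
      of_nat (Suc r) * (of_nat (fact r) * (\<Sum>i\<le>r. symtrace i \<odot> mtrace (Suc (Suc m) + r - i)))"
    by (subst hooksum_rec) (simp add: Suc.IH del: of_nat_Suc)
  also have "\<dots> = of_nat (fact (Suc r)) *
      (symtrace (Suc r) \<odot> mtrace (Suc m) + (\<Sum>i\<le>r. symtrace i \<odot> mtrace (Suc m + Suc r - i)))"
    by (simp only: symsum_eq mul_of_nat_left distrib_left fact_Suc of_nat_mult mult.assoc of_nat_id add_Suc_right add_Suc)
  finally show ?case by (simp add: add.commute)
qed

lemma newton:
  assumes "k > 0"
  shows "of_nat k * symtrace k = (\<Sum>i<k. symtrace i \<odot> mtrace (k - i))"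
proof -
  obtain r where k: "k = Suc r" using assms by (cases k) auto
  let ?s = "\<Sum>i\<le>r. symtrace i \<odot> mtrace (Suc r - i)"
  have "of_nat k * symtrace k = of_nat k *\<^sub>C (1 / fact k) *\<^sub>C symsum k"
    by (simp add: scaleC_of_nat symtrace_def)
  also have "symsum k = of_nat (fact r) *\<^sub>C ?s"
    by (simp add: k symsum_Suc hooksum_eq scaleC_of_nat del: of_nat_fact)
  also have "of_nat k *\<^sub>C (1 / fact k) *\<^sub>C of_nat (fact r) *\<^sub>C ?s = ?s"
    by (simp add: scaleC_scaleC scaleC_one k del: of_nat_Suc)
  finally show ?thesis by (simp add: k lessThan_Suc_atMost)
qed

end

section \<open>From matrices to arrays indexed by all naturals\<close>

definition entries :: "'a::zero mat \<Rightarrow> nat \<Rightarrow> nat \<Rightarrow> 'a" where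
  "entries A i j = (if i < dim_row A \<and> j < dim_col A then A $$ (i, j) else 0)"

lemma entries_transpose: "entries (transpose_mat A) i j = entries A j i"
  by (simp add: entries_def)

text \<open>Each of the four products involves both rows and both columns, so with an index out of
  bounds all of them vanish.\<close>

lemma manin_entries:
  assumes "manin_mat A"
  shows "entries A i j * entries A k l + entries A i l * entries A k j =
    entries A k j * entries A i l + entries A k l * entries A i j"
proof (cases "i < dim_row A \<and> k < dim_row A \<and> j < dim_col A \<and> l < dim_col A")
  case True
  then have "commutator (A $$ (i, j)) (A $$ (k, l)) = commutator (A $$ (k, j)) (A $$ (i, l))"
    using assms by (simp add: manin_mat_def)
  with True show ?thesis
    by (simp add: entries_def commutator_def algebra_simps)
next
  case False
  then show ?thesis by (auto simp: entries_def)
qed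

text \<open>Matrix powers grow on the right, whereas \<open>mpow\<close> in the column case grows on
  the left.\<close>

lemma pow_mat_Suc_left:
  assumes "A \<in> carrier_mat n n"
  shows "A ^\<^sub>m Suc k = A * A ^\<^sub>m k"
proof (induction k)
  case (Suc k)
  have "A ^\<^sub>m Suc (Suc k) = A * A ^\<^sub>m k * A"
    using Suc by simp
  also have "\<dots> = A * (A ^\<^sub>m k * A)"
    using assms by (intro assoc_mult_mat) (auto intro: pow_carrier_mat)
  finally show ?case by simp
qed (use assms in simp)

lemma mat_mult_index:
  assumes "A \<in> carrier_mat n n" "B \<in> carrier_mat n n" "i < n" "j < n"
  shows "(A * B) $$ (i, j) = (\<Sum>z<n. A $$ (i, z) * B $$ (z, j))"
  using assms by (auto simp: scalar_prod_def lessThan_atLeast0 intro!: sum.cong)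

section \<open>Row permanents\<close>

locale row_manin =
  fixes M :: "'a::complex_algebra_1 mat" and n :: nat
  assumes M: "M \<in> carrier_mat n n" and manin_mat: "manin_mat M"
begin

text \<open>Reversing the product exchanges the two sides of the Manin relation, so M itself fits
  the opposite multiplication.\<close>

sublocale manin_array "\<lambda>x y. y * x" "entries M" n
  using manin_entries[OF manin_mat] by unfold_locales (auto simp: add.commute)

lemma mprod_eq: "mprod k f = prod_list (map f (rev [0..<k]))"
  by (induction k) simp_all

lemma mpow_eq: "x < n \<Longrightarrow> y < n \<Longrightarrow> mpow m x y = (M ^\<^sub>m m) $$ (y, x)"
proof (induction m arbitrary: x)
  case (Suc m)
  have "mpow (Suc m) x y = (\<Sum>z<n. (M ^\<^sub>m m) $$ (y, z) * entries M z x)"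
    using Suc by simp
  also have "\<dots> = (\<Sum>z<n. (M ^\<^sub>m m) $$ (y, z) * M $$ (z, x))"
    using Suc.prems M by (simp add: entries_def)
  also have "\<dots> = (M ^\<^sub>m Suc m) $$ (y, x)"
    using Suc.prems by (simp add: mat_mult_index[OF pow_carrier_mat[OF M] M] del: index_mult_mat)
  finally show ?case .
qed (use M in auto)

lemma mtrace_eq: "mtrace m = mat_trace (M ^\<^sub>m m)"
  using M by (simp add: mtrace_def mat_trace_def mpow_eq lessThan_atLeast0)

lemma perm_row_eq:
  assumes "l \<in> {0..<k} \<rightarrow>\<^sub>E {0..<n}"
  shows "perm_row (mat k k (\<lambda>(a, b). M $$ (l a, l b))) =
    (\<Sum>\<sigma> | \<sigma> permutes {0..<k}. prod_list (map (\<lambda>i. entries M (l i) (l (\<sigma> i))) [0..<k]))"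
  unfolding perm_row_def dim_row_mat
proof (intro sum.cong refl arg_cong[where f = prod_list] map_cong)
  fix \<sigma> i assume "\<sigma> \<in> {\<sigma>. \<sigma> permutes {0..<k}}" "i \<in> set [0..<k]"
  moreover from this have "\<sigma> i < k"
    using permutes_in_image[of \<sigma> "{0..<k}" i] by simp
  ultimately show "mat k k (\<lambda>(a, b). M $$ (l a, l b)) $$ (i, \<sigma> i) = entries M (l i) (l (\<sigma> i))"
    using assms M by (auto simp: entries_def PiE_iff)
qed

lemma symsum_eq_perm_row:
  "symsum k = (\<Sum>l\<in>{0..<k} \<rightarrow>\<^sub>E {0..<n}. perm_row (mat k k (\<lambda>(a, b). M $$ (l a, l b))))"
proof -
  \<comment> \<open>Under the reversed multiplication \<open>mprod\<close> runs through the rows backwards.\<close>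
  define \<rho> where "\<rho> i = (if i < k then k - 1 - i else i)" for i
  have \<rho>_invol: "\<rho> (\<rho> i) = i" for i by (auto simp: \<rho>_def)
  have \<rho>: "\<rho> permutes {0..<k}"
    by (rule bij_imp_permutes, rule bij_betw_byWitness[where f' = \<rho>])
      (auto simp: \<rho>_invol, auto simp: \<rho>_def)
  have rev: "rev [0..<k] = map \<rho> [0..<k]"
    by (rule nth_equalityI) (auto simp: rev_nth \<rho>_def)
  \<comment> \<open>Replacing \<sigma> by \<open>\<rho> \<circ> \<sigma> \<circ> \<rho>\<close>
    turns the backward product for l into the forward one for \<open>l \<circ> \<rho>\<close>; the
    sum over tuples then absorbs \<rho>.\<close>
  have "mperm k l l = (\<Sum>\<sigma> | \<sigma> permutes {0..<k}.
      prod_list (map (\<lambda>i. entries M ((l \<circ> \<rho>) i) ((l \<circ> \<rho>) (\<sigma> i))) [0..<k]))" for l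
    unfolding mperm_def
    by (subst setum_permutations_compose_left[OF \<rho>], subst sum_permutations_compose_right[OF \<rho>])
      (simp add: mprod_eq rev comp_def \<rho>_invol)
  then have "symsum k = (\<Sum>l\<in>{0..<k} \<rightarrow>\<^sub>E {0..<n}. \<Sum>\<sigma> | \<sigma> permutes {0..<k}.
      prod_list (map (\<lambda>i. entries M ((l \<circ> \<rho>) i) ((l \<circ> \<rho>) (\<sigma> i))) [0..<k]))"
    by (simp add: symsum_def tuples_def lessThan_atLeast0)
  also have "\<dots> = (\<Sum>l\<in>{0..<k} \<rightarrow>\<^sub>E {0..<n}. \<Sum>\<sigma> | \<sigma> permutes {0..<k}.
      prod_list (map (\<lambda>i. entries M (l i) (l (\<sigma> i))) [0..<k]))"
    by (rule sum_PiE_compose[OF \<rho>])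
  finally show ?thesis by (simp add: perm_row_eq)
qed

lemma symtrace_eq: "symtrace k = sym_pow_trace perm_row M k"
proof (cases "k = 0")
  case True
  then show ?thesis
    by (simp add: symtrace_def sym_pow_trace_def symsum_def tuples_def scaleC_one)
next
  case False
  then show ?thesis
    using M by (simp add: symtrace_def sym_pow_trace_def symsum_eq_perm_row)
qed

lemma newton_row:
  "k > 0 \<Longrightarrow> of_nat k * sym_pow_trace perm_row M k =
     (\<Sum>i<k. mat_trace (M ^\<^sub>m (k - i)) * sym_pow_trace perm_row M i)"
  using newton[of k] by (simp add: symtrace_eq mtrace_eq)

end

section \<open>Column permanents\<close>

locale col_manin =
  fixes M :: "'a::complex_algebra_1 mat" and n :: nat
  assumes M: "M \<in> carrier_mat n n" and manin_mat: "manin_mat (transpose_mat M)"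
begin

text \<open>The rows of the transposed array are the columns of M, so the factors already come in
  the order of \<open>perm_col\<close>.\<close>

sublocale manin_array "(*)" "\<lambda>i j. entries M j i" n
  using manin_entries[OF manin_mat] by unfold_locales (auto simp: entries_transpose)

lemma mprod_eq: "mprod k f = prod_list (map f [0..<k])"
  by (induction k) simp_all

lemma mpow_eq: "x < n \<Longrightarrow> y < n \<Longrightarrow> mpow m x y = (M ^\<^sub>m m) $$ (x, y)"
proof (induction m arbitrary: x)
  case (Suc m)
  have "mpow (Suc m) x y = (\<Sum>z<n. entries M x z * (M ^\<^sub>m m) $$ (z, y))"
    using Suc by simp
  also have "\<dots> = (\<Sum>z<n. M $$ (x, z) * (M ^\<^sub>m m) $$ (z, y))"
    using Suc.prems M by (simp add: entries_def)
  also have "\<dots> = (M ^\<^sub>m Suc m) $$ (x, y)"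
    using Suc.prems by (simp only: pow_mat_Suc_left[OF M] mat_mult_index[OF M pow_carrier_mat[OF M]])
  finally show ?case .
qed (use M in auto)

lemma mtrace_eq: "mtrace m = mat_trace (M ^\<^sub>m m)"
  using M by (simp add: mtrace_def mat_trace_def mpow_eq lessThan_atLeast0)

lemma mperm_eq_perm_col:
  assumes "l \<in> {0..<k} \<rightarrow>\<^sub>E {0..<n}"
  shows "mperm k l l = perm_col (mat k k (\<lambda>(a, b). M $$ (l a, l b)))"
  unfolding perm_col_def mperm_def mprod_eq dim_col_mat
proof (intro sum.cong refl arg_cong[where f = prod_list] map_cong)
  fix \<sigma> i assume "\<sigma> \<in> {\<sigma>. \<sigma> permutes {0..<k}}" "i \<in> set [0..<k]"
  moreover from this have "\<sigma> i < k"
    using permutes_in_image[of \<sigma> "{0..<k}" i] by simp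
  ultimately show "entries M (l (\<sigma> i)) (l i) = mat k k (\<lambda>(a, b). M $$ (l a, l b)) $$ (\<sigma> i, i)"
    using assms M by (auto simp: entries_def PiE_iff)
qed

lemma symtrace_eq: "symtrace k = sym_pow_trace perm_col M k"
proof (cases "k = 0")
  case True
  then show ?thesis
    by (simp add: symtrace_def sym_pow_trace_def symsum_def tuples_def scaleC_one)
next
  case False
  then show ?thesis
    using M by (simp add: symtrace_def sym_pow_trace_def symsum_def tuples_def mperm_eq_perm_col
        lessThan_atLeast0)
qed

lemma newton_col:
  "k > 0 \<Longrightarrow> of_nat k * sym_pow_trace perm_col M k =
     (\<Sum>i<k. sym_pow_trace perm_col M i * mat_trace (M ^\<^sub>m (k - i)))"
  using newton[of k] by (simp add: symtrace_eq mtrace_eq)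

end

section \<open>The resolvent and the generating series\<close>

text \<open>R is the geometric series of tM. As a two-sided inverse of 1 - tM it is unique, which
  gives M/(1 - tM) its meaning.\<close>

lemma resolvent_series:
  fixes M :: "'a::ring_1 mat"
  assumes M: "M \<in> carrier_mat n n"
  defines "C \<equiv> map_mat fps_const M"
    and "R \<equiv> mat n n (\<lambda>(i, j). Abs_fps (\<lambda>k. (M ^\<^sub>m k) $$ (i, j)))"
  shows "(1\<^sub>m n - fps_X \<cdot>\<^sub>m C) * R = 1\<^sub>m n"
    and "R * (1\<^sub>m n - fps_X \<cdot>\<^sub>m C) = 1\<^sub>m n"
    and "trace_series M = mat_trace (C * R)"
proof -
  have C: "C \<in> carrier_mat n n" using M by (simp add: C_def)
  have R: "R \<in> carrier_mat n n" by (simp add: R_def)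
  have XC: "1\<^sub>m n - fps_X \<cdot>\<^sub>m C \<in> carrier_mat n n" using C by auto
  have CR: "fps_nth ((C * R) $$ (i, j)) k = (M ^\<^sub>m Suc k) $$ (i, j)" if "i < n" "j < n" for i j k
    using that M unfolding mat_mult_index[OF C R that] pow_mat_Suc_left[OF M]
      mat_mult_index[OF M pow_carrier_mat[OF M] that]
    by (simp add: fps_sum_nth C_def R_def)
  have RC: "fps_nth ((R * C) $$ (i, j)) k = (M ^\<^sub>m Suc k) $$ (i, j)" if "i < n" "j < n" for i j k
    using that M unfolding mat_mult_index[OF R C that] pow_mat.simps
      mat_mult_index[OF pow_carrier_mat[OF M] M that]
    by (simp add: fps_sum_nth C_def R_def)
  have R_rec: "R $$ (i, j) = (if i = j then 1 else 0) + fps_X * (C * R) $$ (i, j)"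
    if "i < n" "j < n" for i j
  proof (rule fps_ext)
    fix k show "fps_nth (R $$ (i, j)) k =
        fps_nth ((if i = j then 1 else 0) + fps_X * (C * R) $$ (i, j)) k"
      using that M CR[OF that]
      by (cases k) (simp_all add: R_def del: pow_mat.simps(2) index_mult_mat)
  qed
  \<comment> \<open>C and R commute, so \<open>R_rec\<close> also serves for the right
    factor.\<close>
  have RC_eq: "(R * C) $$ (i, j) = (C * R) $$ (i, j)" if "i < n" "j < n" for i j
    by (rule fps_ext) (simp add: CR RC that del: index_mult_mat)
  show "(1\<^sub>m n - fps_X \<cdot>\<^sub>m C) * R = 1\<^sub>m n"
  proof (rule eq_matI)
    fix i j assume "i < dim_row (1\<^sub>m n :: 'a fps mat)" "j < dim_col (1\<^sub>m n :: 'a fps mat)"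
    then have ij: "i < n" "j < n" by auto
    have "((1\<^sub>m n - fps_X \<cdot>\<^sub>m C) * R) $$ (i, j) =
        (\<Sum>z<n. (if i = z then R $$ (z, j) else 0) - fps_X * (C $$ (i, z) * R $$ (z, j)))"
      unfolding mat_mult_index[OF XC R ij] using ij C
      by (intro sum.cong) (auto simp: left_diff_distrib mult.assoc)
    also have "\<dots> = R $$ (i, j) - fps_X * (C * R) $$ (i, j)"
      unfolding mat_mult_index[OF C R ij] using ij
      by (simp add: sum_subtractf sum_distrib_left)
    finally show "((1\<^sub>m n - fps_X \<cdot>\<^sub>m C) * R) $$ (i, j) = 1\<^sub>m n $$ (i, j)"
      using ij R_rec[OF ij] by (simp del: index_mult_mat)
  qed (use C R in auto)
  show "R * (1\<^sub>m n - fps_X \<cdot>\<^sub>m C) = 1\<^sub>m n"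
  proof (rule eq_matI)
    fix i j assume "i < dim_row (1\<^sub>m n :: 'a fps mat)" "j < dim_col (1\<^sub>m n :: 'a fps mat)"
    then have ij: "i < n" "j < n" by auto
    \<comment> \<open>The variable is central even though the coefficients do not commute.\<close>
    have "R $$ (i, z) * (fps_X * C $$ (z, j)) = fps_X * (R $$ (i, z) * C $$ (z, j))" for z
      by (simp add: fps_mult_fps_X_commute[symmetric] flip: mult.assoc)
    then have "(R * (1\<^sub>m n - fps_X \<cdot>\<^sub>m C)) $$ (i, j) =
        (\<Sum>z<n. (if z = j then R $$ (i, z) else 0) - fps_X * (R $$ (i, z) * C $$ (z, j)))"
      unfolding mat_mult_index[OF R XC ij] using ij C
      by (intro sum.cong) (auto simp: right_diff_distrib)
    also have "\<dots> = R $$ (i, j) - fps_X * (R * C) $$ (i, j)"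
      unfolding mat_mult_index[OF R C ij] using ij
      by (simp add: sum_subtractf sum_distrib_left)
    finally show "(R * (1\<^sub>m n - fps_X \<cdot>\<^sub>m C)) $$ (i, j) = 1\<^sub>m n $$ (i, j)"
      using ij R_rec[OF ij] RC_eq[OF ij] by (simp del: index_mult_mat)
  qed (use C R in auto)
  show "trace_series M = mat_trace (C * R)"
    using M C R CR
    by (intro fps_ext) (simp add: trace_series_def mat_trace_def fps_sum_nth del: index_mult_mat(1) pow_mat.simps(2))
qed

lemma atLeastAtMost_pred: "k > 0 \<Longrightarrow> {0..k - 1} = {..<k}" for k :: nat
  by auto

theorem theorem16:
  fixes M :: "'a::complex_algebra_1 mat" and n :: nat
  assumes M: "M \<in> carrier_mat n n"
  shows
    "(\<exists>R \<in> carrier_mat n n.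
        inverts_mat (1\<^sub>m n - fps_X \<cdot>\<^sub>m map_mat fps_const M) R \<and>
        inverts_mat R (1\<^sub>m n - fps_X \<cdot>\<^sub>m map_mat fps_const M) \<and>
        trace_series M = mat_trace (map_mat fps_const M * R)) \<and>
     (manin_mat M \<longrightarrow>
        fps_deriv (sym_series perm_row M) = trace_series M * sym_series perm_row M \<and>
        (\<forall>k>0. of_nat k * sym_pow_trace perm_row M k =
           (\<Sum>i\<in>{0..k-1}. mat_trace (M ^\<^sub>m (k - i)) * sym_pow_trace perm_row M i))) \<and>
     (manin_mat (transpose_mat M) \<longrightarrow>
        fps_deriv (sym_series perm_col M) = sym_series perm_col M * trace_series M \<and>
        (\<forall>k>0. of_nat k * sym_pow_trace perm_col M k =
           (\<Sum>i\<in>{0..k-1}. sym_pow_trace perm_col M i * mat_trace (M ^\<^sub>m (k - i)))))"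
proof (intro conjI impI)
  show "\<exists>R \<in> carrier_mat n n.
        inverts_mat (1\<^sub>m n - fps_X \<cdot>\<^sub>m map_mat fps_const M) R \<and>
        inverts_mat R (1\<^sub>m n - fps_X \<cdot>\<^sub>m map_mat fps_const M) \<and>
        trace_series M = mat_trace (map_mat fps_const M * R)"
    using resolvent_series[OF M] M
    by (intro bexI[of _ "mat n n (\<lambda>(i, j). Abs_fps (\<lambda>k. (M ^\<^sub>m k) $$ (i, j)))"])
      (simp_all add: inverts_mat_def)
next
  assume "manin_mat M"
  then interpret row_manin M n by unfold_locales (rule M)
  show "\<forall>k>0. of_nat k * sym_pow_trace perm_row M k =
      (\<Sum>i\<in>{0..k-1}. mat_trace (M ^\<^sub>m (k - i)) * sym_pow_trace perm_row M i)"
    using newton_row by (simp add: atLeastAtMost_pred del: One_nat_def)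
  show "fps_deriv (sym_series perm_row M) = trace_series M * sym_series perm_row M"
  proof (rule fps_ext)
    fix k
    have "fps_nth (fps_deriv (sym_series perm_row M)) k =
        (\<Sum>i\<le>k. mat_trace (M ^\<^sub>m (Suc k - i)) * sym_pow_trace perm_row M i)"
      using newton_row[of "Suc k"] by (simp add: sym_series_def lessThan_Suc_atMost del: of_nat_Suc)
    \<comment> \<open>The Cauchy product is indexed by its first factor, here the trace series, so
      the summation is reversed.\<close>
    also have "\<dots> = (\<Sum>i\<le>k. mat_trace (M ^\<^sub>m (Suc i)) * sym_pow_trace perm_row M (k - i))"
      by (subst sum.nat_diff_reindex[symmetric, of _ "Suc k", unfolded lessThan_Suc_atMost])
        (intro sum.cong, auto simp: Suc_diff_le simp del: pow_mat.simps)
    also have "\<dots> = fps_nth (trace_series M * sym_series perm_row M) k"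
      by (simp add: fps_mult_nth trace_series_def sym_series_def atLeast0AtMost)
    finally show "fps_nth (fps_deriv (sym_series perm_row M)) k = fps_nth (trace_series M * sym_series perm_row M) k" .
  qed
next
  assume "manin_mat (transpose_mat M)"
  then interpret col_manin M n by unfold_locales (rule M)
  show "\<forall>k>0. of_nat k * sym_pow_trace perm_col M k =
      (\<Sum>i\<in>{0..k-1}. sym_pow_trace perm_col M i * mat_trace (M ^\<^sub>m (k - i)))"
    using newton_col by (simp add: atLeastAtMost_pred del: One_nat_def)
  show "fps_deriv (sym_series perm_col M) = sym_series perm_col M * trace_series M"
  proof (rule fps_ext)
    fix k
    show "fps_nth (fps_deriv (sym_series perm_col M)) k = fps_nth (sym_series perm_col M * trace_series M) k"
      using newton_col[of "Suc k"]
      by (simp add: fps_mult_nth trace_series_def sym_series_def atLeast0AtMost lessThan_Suc_atMost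
          Suc_diff_le del: of_nat_Suc pow_mat.simps)
  qed
qed

end
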